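(* Let $(\pi,\lambda,\tau)$ be combinatorial-length-suspension data on an alphabet with $d$ letters, which admit infinitely many steps of the inverse of the Rauzy-Veech map and whose past half-infinite Rauzy path has a strongly complete ending segment. Let $m$ be the minimal positive integer such that the path formed by the last $m$ arrows, going from $\pi^{(-m)}$ to $\pi^{(0)}=\pi$, is strongly complete, and let $$m(\pi,\lambda,\tau)=\min_{-m\le r\le0}w(\pi^{(r)},\lambda^{(r)},\tau^{(r)}).$$ Then the distortion $\Delta(T)=\max_{\alpha,\beta\in\mathcal{A}}\lambda_\alpha/\lambda_\beta$ of the interval exchange transformation $T=(\pi,\lambda)$ satisfies $$\Delta(T)\le\frac{d!}{m(\pi,\lambda,\tau)^{d-1}}.$$
   Context: Let $\mathcal{A}$ be a finite alphabet with $d\ge2$ letters. A combinatorial datum is a pair $\pi=(\pi^t,\pi^b)$ of bijections $\mathcal{A}\to\{1,\dots,d\}$, always assumed admissible: there is no nonempty proper subset $\mathcal{A}'\subset\mathcal{A}$ with $k<d$ elements and $\pi^t(\mathcal{A}')=\pi^b(\mathcal{A}')=\{1,\dots,k\}$. A length datum is $\lambda\in\mathbb{R}_+^{\mathcal{A}}$. A suspension datum for $\pi$ is $\tau\in\mathbb{R}^{\mathcal{A}}$ with $\sum_{\pi^t(\chi)\le k}\tau_\chi>0$ and $\sum_{\pi^b(\chi)\le k}\tau_\chi<0$ for $1\le k\le d-1$. Rauzy-Veech map $\widehat Q$: let $\alpha_t,\alpha_b$ be the letters with $\pi^t(\alpha_t)=\pi^b(\alpha_b)=d$, and assume $\lambda_{\alpha_t}\ne\lambda_{\alpha_b}$.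 Let $\epsilon=t$ if $\lambda_{\alpha_t}>\lambda_{\alpha_b}$ and $\epsilon=b$ otherwise, and $1-\epsilon$ the other symbol. Then $\widehat Q(\pi,\lambda,\tau)=(\tilde\pi,\tilde\lambda,\tilde\tau)$, where $\tilde\pi^\epsilon=\pi^\epsilon$; $\tilde\pi^{1-\epsilon}$ is obtained from $\pi^{1-\epsilon}$ by moving the last letter $\alpha_{1-\epsilon}$ immediately after $\alpha_\epsilon$; $\tilde\lambda_{\alpha_\epsilon}=\lambda_{\alpha_\epsilon}-\lambda_{\alpha_{1-\epsilon}}$, $\tilde\tau_{\alpha_\epsilon}=\tau_{\alpha_\epsilon}-\tau_{\alpha_{1-\epsilon}}$, other entries unchanged. The step is recorded by an arrow $\pi\to\tilde\pi$ with winner $\alpha_\epsilon$ and loser $\alpha_{1-\epsilon}$; a Rauzy path is a concatenation of compatible arrows. $\widehat Q$ is injective, and $(\pi^{(r)},\lambda^{(r)},\tau^{(r)})=\widehat Q^r(\pi,\lambda,\tau)$ for $r\in\mathbb{Z}$ when defined. A finite Rauzy path is complete if every letter of $\mathcal{A}$ is the winner of at least one of its arrows, and strongly complete if it is a concatenation of $d$ complete paths. Function $w$: put $h_\alpha=\sum_{\pi^t(\chi)<\pi^t(\alpha)}\tau_\chi-\sum_{\pi^b(\chi)<\pi^b(\alpha)}\tau_\chi$ (so $\sum_\alpha\lambda_\alpha h_\alpha>0$ is the area of the associated translation surface). For letters with $\pi^b(\beta)>1$, $\pi^t(\alpha)>1$ let $w_{\pi,\beta,\alpha}=\sum_{\pi^b(\chi)<\pi^b(\beta)}e_\chi-\sum_{\pi^t(\chi)<\pi^t(\alpha)}e_\chi\in\mathbb{Z}^{\mathcal{A}}$,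 and $$w(\pi,\lambda,\tau)=\frac{1}{\sum_\alpha\lambda_\alpha h_\alpha}\ \min_{\pi^b(\beta)>1,\ \pi^t(\alpha)>1}|\langle\lambda,w_{\pi,\beta,\alpha}\rangle|\cdot|\langle\tau,w_{\pi,\beta,\alpha}\rangle|.$$ *)

theory Defs
  imports Complex_Main "HOL-Library.Cardinality" "HOL-Library.Extended_Real"
begin

text \<open>
  The alphabet is the universe of a finite type \<open>'a\<close>, so that \<open>d = CARD('a)\<close>.  A pair
  \<open>\<pi> = (\<pi>\<^sup>t, \<pi>\<^sup>b)\<close> is encoded as a function on the two-element type of symbols \<open>t\<close>, \<open>b\<close>.
  Length data are written \<open>lam\<close>.
\<close>

datatype side = Top | Bot

fun opp :: "side \<Rightarrow> side" where
  "opp Top = Bot"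
| "opp Bot = Top"

type_synonym 'a comb = "side \<Rightarrow> 'a \<Rightarrow> nat"
type_synonym 'a vec = "'a \<Rightarrow> real"
type_synonym 'a data = "'a comb \<times> 'a vec \<times> 'a vec"

definition admissible :: "'a::finite comb \<Rightarrow> bool" where
  "admissible \<pi> \<longleftrightarrow>
     \<not> (\<exists>A k. A \<noteq> {} \<and> A \<noteq> UNIV \<and> card A = k \<and> k < CARD('a) \<and>
            \<pi> Top ` A = {1..k} \<and> \<pi> Bot ` A = {1..k})"

definition combinatorial_datum :: "'a::finite comb \<Rightarrow> bool" where
  "combinatorial_datum \<pi> \<longleftrightarrow> (\<forall>\<epsilon>. bij_betw (\<pi> \<epsilon>) UNIV {1..CARD('a)}) \<and> admissible \<pi>"

definition length_datum :: "'a vec \<Rightarrow> bool" where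
  "length_datum lam \<longleftrightarrow> (\<forall>\<alpha>. lam \<alpha> > 0)"

definition suspension_datum :: "'a::finite comb \<Rightarrow> 'a vec \<Rightarrow> bool" where
  "suspension_datum \<pi> \<tau> \<longleftrightarrow>
     (\<forall>k. 1 \<le> k \<and> k \<le> CARD('a) - 1 \<longrightarrow>
        (\<Sum>\<chi> | \<pi> Top \<chi> \<le> k. \<tau> \<chi>) > 0 \<and> (\<Sum>\<chi> | \<pi> Bot \<chi> \<le> k. \<tau> \<chi>) < 0)"

definition cls_data :: "'a::finite data set" where
  "cls_data = {(\<pi>, lam, \<tau>). combinatorial_datum \<pi> \<and> length_datum lam \<and> suspension_datum \<pi> \<tau>}"


subsection \<open>The Rauzy-Veech map\<close>

definition last_letter :: "'a::finite comb \<Rightarrow> side \<Rightarrow> 'a" where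
  "last_letter \<pi> \<epsilon> = (THE \<alpha>. \<pi> \<epsilon> \<alpha> = CARD('a))"

text \<open>An arrow is given by its source together with its type \<open>\<epsilon>\<close>.\<close>

type_synonym 'a arrow = "'a comb \<times> side"

definition winner :: "'a::finite arrow \<Rightarrow> 'a" where
  "winner = (\<lambda>(\<pi>, \<epsilon>). last_letter \<pi> \<epsilon>)"

definition loser :: "'a::finite arrow \<Rightarrow> 'a" where
  "loser = (\<lambda>(\<pi>, \<epsilon>). last_letter \<pi> (opp \<epsilon>))"

definition source :: "'a arrow \<Rightarrow> 'a comb" where
  "source = fst"

text \<open>
  In row \<open>opp \<epsilon>\<close> the loser moves to the position following the winner, and the letters
  that were between the two are shifted one place to the right.
\<close>

definition target :: "'a::finite arrow \<Rightarrow> 'a comb" where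
  "target = (\<lambda>(\<pi>, \<epsilon>).
     let p = \<pi> (opp \<epsilon>) (winner (\<pi>, \<epsilon>)) in
       \<pi> (opp \<epsilon> := (\<lambda>\<chi>. if \<chi> = loser (\<pi>, \<epsilon>) then p + 1
                           else if \<pi> (opp \<epsilon>) \<chi> \<le> p then \<pi> (opp \<epsilon>) \<chi>
                           else \<pi> (opp \<epsilon>) \<chi> + 1)))"

definition rv_arrow :: "'a::finite data \<Rightarrow> 'a arrow" where
  "rv_arrow = (\<lambda>(\<pi>, lam, \<tau>).
     (\<pi>, if lam (last_letter \<pi> Top) > lam (last_letter \<pi> Bot) then Top else Bot))"

definition rv_domain :: "'a::finite data set" where
  "rv_domain = {(\<pi>, lam, \<tau>) \<in> cls_data. lam (last_letter \<pi> Top) \<noteq> lam (last_letter \<pi> Bot)}"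

definition rv_map :: "'a::finite data \<Rightarrow> 'a data" where
  "rv_map = (\<lambda>(\<pi>, lam, \<tau>).
     let \<gamma> = rv_arrow (\<pi>, lam, \<tau>); w = winner \<gamma>; l = loser \<gamma> in
       (target \<gamma>, lam(w := lam w - lam l), \<tau>(w := \<tau> w - \<tau> l)))"

text \<open>
  \<open>rv_map\<close> is injective on \<open>rv_domain\<close>, so \<open>rv_inv\<close> is its inverse, which is meaningful on
  \<open>rv_map ` rv_domain\<close> only.  \<open>rv_past n x\<close> is \<open>x\<^bsup>(-n)\<^esup>\<close>, defined as long as all the inverse
  steps are.
\<close>

definition rv_inv :: "'a::finite data \<Rightarrow> 'a data" where
  "rv_inv = inv_into rv_domain rv_map"

definition rv_past :: "nat \<Rightarrow> 'a::finite data \<Rightarrow> 'a data" where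
  "rv_past n x = (rv_inv ^^ n) x"

definition infinite_past :: "'a::finite data \<Rightarrow> bool" where
  "infinite_past x \<longleftrightarrow> (\<forall>n. rv_past n x \<in> rv_map ` rv_domain)"


subsection \<open>Rauzy paths\<close>

definition rauzy_path :: "'a::finite arrow list \<Rightarrow> bool" where
  "rauzy_path \<gamma>s \<longleftrightarrow> (\<forall>\<gamma>\<in>set \<gamma>s. combinatorial_datum (source \<gamma>)) \<and>
     successively (\<lambda>\<gamma> \<gamma>'. target \<gamma> = source \<gamma>') \<gamma>s"

definition complete_path :: "'a::finite arrow list \<Rightarrow> bool" where
  "complete_path \<gamma>s \<longleftrightarrow> rauzy_path \<gamma>s \<and> (\<forall>\<alpha>. \<exists>\<gamma>\<in>set \<gamma>s. winner \<gamma> = \<alpha>)"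

definition strongly_complete_path :: "'a::finite arrow list \<Rightarrow> bool" where
  "strongly_complete_path \<gamma>s \<longleftrightarrow> rauzy_path \<gamma>s \<and>
     (\<exists>ps. length ps = CARD('a) \<and> (\<forall>p\<in>set ps. complete_path p) \<and> \<gamma>s = concat ps)"

text \<open>The last \<open>m\<close> arrows of the past, from \<open>\<pi>\<^bsup>(-m)\<^esup>\<close> to \<open>\<pi>\<^bsup>(0)\<^esup>\<close>, in the order of travel.\<close>

definition past_path :: "'a::finite data \<Rightarrow> nat \<Rightarrow> 'a arrow list" where
  "past_path x m = map (\<lambda>n. rv_arrow (rv_past n x)) (rev [1..<Suc m])"

definition min_past_length :: "'a::finite data \<Rightarrow> nat" where
  "min_past_length x = (LEAST m. 0 < m \<and> strongly_complete_path (past_path x m))"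


subsection \<open>The function \<open>w\<close>, its minimum along the past, and the distortion\<close>

definition height :: "'a::finite comb \<Rightarrow> 'a vec \<Rightarrow> 'a vec" where
  "height \<pi> \<tau> \<alpha> =
     (\<Sum>\<chi> | \<pi> Top \<chi> < \<pi> Top \<alpha>. \<tau> \<chi>) - (\<Sum>\<chi> | \<pi> Bot \<chi> < \<pi> Bot \<alpha>. \<tau> \<chi>)"

definition area :: "'a::finite data \<Rightarrow> real" where
  "area = (\<lambda>(\<pi>, lam, \<tau>). \<Sum>\<alpha>\<in>UNIV. lam \<alpha> * height \<pi> \<tau> \<alpha>)"

definition unit_vec :: "'a \<Rightarrow> 'a \<Rightarrow> int" where
  "unit_vec \<chi> = (\<lambda>\<alpha>. if \<alpha> = \<chi> then 1 else 0)"

definition w_vec :: "'a::finite comb \<Rightarrow> 'a \<Rightarrow> 'a \<Rightarrow> 'a \<Rightarrow> int" where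
  "w_vec \<pi> \<beta> \<alpha> = (\<lambda>\<xi>.
     (\<Sum>\<chi> | \<pi> Bot \<chi> < \<pi> Bot \<beta>. unit_vec \<chi> \<xi>) - (\<Sum>\<chi> | \<pi> Top \<chi> < \<pi> Top \<alpha>. unit_vec \<chi> \<xi>))"

definition pairing :: "'a::finite vec \<Rightarrow> ('a \<Rightarrow> int) \<Rightarrow> real" where
  "pairing v u = (\<Sum>\<xi>\<in>UNIV. v \<xi> * of_int (u \<xi>))"

definition w_fun :: "'a::finite data \<Rightarrow> real" where
  "w_fun = (\<lambda>(\<pi>, lam, \<tau>).
     1 / area (\<pi>, lam, \<tau>) *
     Min {\<bar>pairing lam (w_vec \<pi> \<beta> \<alpha>)\<bar> * \<bar>pairing \<tau> (w_vec \<pi> \<beta> \<alpha>)\<bar> | \<beta> \<alpha>.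
            \<pi> Bot \<beta> > 1 \<and> \<pi> Top \<alpha> > 1})"

text \<open>
  \<open>min_w\<close> can be \<open>0\<close> (for instance when \<open>lam\<close> is constant), so a bound by a quotient with a power
  of it in the denominator has to be read in the extended reals, where \<open>c / 0 = \<infinity>\<close> for \<open>c > 0\<close>.
\<close>

definition min_w :: "'a::finite data \<Rightarrow> real" where
  "min_w x = Min ((\<lambda>n. w_fun (rv_past n x)) ` {0..min_past_length x})"

definition distortion :: "'a::finite vec \<Rightarrow> real" where
  "distortion lam = Max {lam \<alpha> / lam \<beta> | \<alpha> \<beta>. True}"

end

theory Submission
  imports Defs
begin

text \<open>
  Let \<open>\<mu>\<close> be the minimum of the function \<open>w\<close> along the path.  Applied to the two last letters, it
  says that after every step the new length of the winner is at least \<open>\<mu>\<close> times the length of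
  the loser.  Lengths only decrease in time, and the length of a letter is final after its last win.

  Let \<open>S\<close> be a nonempty proper set of letters whose final lengths are at most \<open>c\<close>.  Go back from
  the last win of a letter of \<open>S\<close> to the closest arrow that involves a letter outside \<open>S\<close>; there
  \<open>w \<in> S\<close> beats some \<open>l \<notin> S\<close>, since consecutive arrows share the winner of the first one.
  In the row where \<open>l\<close> is inserted after \<open>w\<close>, every letter that \<open>w\<close> beats later is inserted
  before \<open>l\<close> as well and cannot come back behind \<open>l\<close>.  So \<open>w\<close>, the letters that it beats,
  the letters that these beat, and so on, form a tree without repetitions, and the length of \<open>w\<close>
  after beating \<open>l\<close> is at most the final total length of \<open>S\<close>, that is \<open>|S| c\<close>.  Hence the length
  of \<open>l\<close> is at most \<open>|S| c / \<mu>\<close>.  Starting from one letter and adding letters one at a time gives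
  the distortion bound \<open>(d-1)! / \<mu>\<^bsup>d-1\<^esup>\<close>.
\<close>

section \<open>Positions in the two rows and signs of suspension data\<close>

lemma combinatorial_datum_bij:
  fixes \<pi> :: "'a::finite comb"
  assumes "combinatorial_datum \<pi>"
  shows "bij_betw (\<pi> \<epsilon>) UNIV {1..CARD('a)}"
  using assms by (auto simp: combinatorial_datum_def)

lemma combinatorial_datum_range:
  fixes \<pi> :: "'a::finite comb"
  assumes "combinatorial_datum \<pi>"
  shows "1 \<le> \<pi> \<epsilon> \<alpha>" and "\<pi> \<epsilon> \<alpha> \<le> CARD('a)"
  using bij_betwE[OF combinatorial_datum_bij[OF assms], of \<epsilon>] by auto

lemma combinatorial_datum_inj:
  fixes \<pi> :: "'a::finite comb"
  assumes "combinatorial_datum \<pi>"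
  shows "\<pi> \<epsilon> \<alpha> = \<pi> \<epsilon> \<beta> \<longleftrightarrow> \<alpha> = \<beta>"
  using combinatorial_datum_bij[OF assms, of \<epsilon>] by (auto simp: bij_betw_def inj_def)

lemma last_letter_iff:
  fixes \<pi> :: "'a::finite comb"
  assumes "combinatorial_datum \<pi>"
  shows "\<pi> \<epsilon> \<alpha> = CARD('a) \<longleftrightarrow> \<alpha> = last_letter \<pi> \<epsilon>"
proof -
  have "\<pi> \<epsilon> ` UNIV = {1..CARD('a)}"
    using combinatorial_datum_bij[OF assms] by (rule bij_betw_imp_surj_on)
  moreover have "CARD('a) \<in> {1..CARD('a)}"
    using zero_less_card_finite[where 'a = 'a] by (simp add: Suc_le_eq)
  ultimately obtain \<beta> where \<beta>: "\<pi> \<epsilon> \<beta> = CARD('a)" by (metis imageE)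
  have iff: "\<pi> \<epsilon> \<gamma> = CARD('a) \<longleftrightarrow> \<gamma> = \<beta>" for \<gamma>
    unfolding \<beta>[symmetric] by (rule combinatorial_datum_inj[OF assms])
  then have "last_letter \<pi> \<epsilon> = \<beta>"
    by (simp add: last_letter_def)
  then show ?thesis using iff by simp
qed

lemma sum_before_last_letter:
  fixes \<pi> :: "'a::finite comb" and v :: "'a \<Rightarrow> real"
  assumes "combinatorial_datum \<pi>"
  shows "(\<Sum>\<chi> | \<pi> \<epsilon> \<chi> < \<pi> \<epsilon> (last_letter \<pi> \<epsilon>). v \<chi>) = sum v UNIV - v (last_letter \<pi> \<epsilon>)"
proof -
  have last: "\<pi> \<epsilon> (last_letter \<pi> \<epsilon>) = CARD('a)"
    using last_letter_iff[OF assms] by blast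
  have "{\<chi>. \<pi> \<epsilon> \<chi> < CARD('a)} = UNIV - {last_letter \<pi> \<epsilon>}"
    using combinatorial_datum_range(2)[OF assms, of \<epsilon>] last_letter_iff[OF assms, of \<epsilon>]
    by (auto simp: less_le)
  then show ?thesis
    unfolding last by (simp add: sum_diff1)
qed

lemma suspension_datum_before:
  fixes \<pi> :: "'a::finite comb"
  assumes "combinatorial_datum \<pi>" and "suspension_datum \<pi> \<tau>"
  shows "\<pi> Top \<alpha> > 1 \<Longrightarrow> (\<Sum>\<chi> | \<pi> Top \<chi> < \<pi> Top \<alpha>. \<tau> \<chi>) > 0"
    and "\<pi> Bot \<alpha> > 1 \<Longrightarrow> (\<Sum>\<chi> | \<pi> Bot \<chi> < \<pi> Bot \<alpha>. \<tau> \<chi>) < 0"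
    and "(\<Sum>\<chi> | \<pi> Top \<chi> < \<pi> Top \<alpha>. \<tau> \<chi>) \<ge> 0"
    and "(\<Sum>\<chi> | \<pi> Bot \<chi> < \<pi> Bot \<alpha>. \<tau> \<chi>) \<le> 0"
proof -
  have set: "{\<chi>. \<pi> \<epsilon> \<chi> < \<pi> \<epsilon> \<alpha>} = {\<chi>. \<pi> \<epsilon> \<chi> \<le> \<pi> \<epsilon> \<alpha> - 1}" for \<epsilon>
    using combinatorial_datum_range(1)[OF assms(1), of \<epsilon> \<alpha>] by auto
  have bound: "\<pi> \<epsilon> \<alpha> - 1 \<le> CARD('a) - 1" for \<epsilon>
    using combinatorial_datum_range(2)[OF assms(1), of \<epsilon> \<alpha>] by simp
  show top: "(\<Sum>\<chi> | \<pi> Top \<chi> < \<pi> Top \<alpha>. \<tau> \<chi>) > 0" if "\<pi> Top \<alpha> > 1"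
    using assms(2) that bound[of Top] unfolding suspension_datum_def set by auto
  show bot: "(\<Sum>\<chi> | \<pi> Bot \<chi> < \<pi> Bot \<alpha>. \<tau> \<chi>) < 0" if "\<pi> Bot \<alpha> > 1"
    using assms(2) that bound[of Bot] unfolding suspension_datum_def set by auto
  \<comment> \<open>The strict signs concern prefixes of \<open>1\<close> to \<open>d - 1\<close>
    letters; before a first letter the prefix is empty and its sum is \<open>0\<close>.\<close>
  have empty: "{\<chi>. \<pi> \<epsilon> \<chi> < \<pi> \<epsilon> \<alpha>} = {}" if "\<not> \<pi> \<epsilon> \<alpha> > 1" for \<epsilon>
    using that combinatorial_datum_range(1)[OF assms(1), of \<epsilon>]
    by (metis (mono_tags, lifting) empty_Collect_eq not_less order_less_le_trans)
  show "(\<Sum>\<chi> | \<pi> Top \<chi> < \<pi> Top \<alpha>. \<tau> \<chi>) \<ge> 0"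
    using top empty[of Top] by (cases "\<pi> Top \<alpha> > 1") auto
  show "(\<Sum>\<chi> | \<pi> Bot \<chi> < \<pi> Bot \<alpha>. \<tau> \<chi>) \<le> 0"
    using bot empty[of Bot] by (cases "\<pi> Bot \<alpha> > 1") auto
qed

lemma height_nonneg:
  fixes \<pi> :: "'a::finite comb"
  assumes "combinatorial_datum \<pi>" and "suspension_datum \<pi> \<tau>"
  shows "height \<pi> \<tau> \<alpha> \<ge> 0"
  using suspension_datum_before(3,4)[OF assms, of \<alpha>] by (simp add: height_def)

lemma area_nonneg:
  assumes "(\<pi>, lam, \<tau>) \<in> cls_data"
  shows "area (\<pi>, lam, \<tau>) \<ge> 0"
  using assms height_nonneg[of \<pi> \<tau>]
  by (auto simp: area_def cls_data_def length_datum_def less_imp_le intro!: sum_nonneg)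

section \<open>The minimum that defines \<open>w_fun\<close>\<close>

lemma pairing_w_vec:
  "pairing v (w_vec \<pi> \<beta> \<alpha>) =
     (\<Sum>\<chi> | \<pi> Bot \<chi> < \<pi> Bot \<beta>. v \<chi>) - (\<Sum>\<chi> | \<pi> Top \<chi> < \<pi> Top \<alpha>. v \<chi>)"
proof -
  have unit: "(\<Sum>\<chi> | P \<chi>. unit_vec \<chi> \<xi>) = (if P \<xi> then 1 else 0)" for P and \<xi> :: 'a
    by (simp add: unit_vec_def)
  have "pairing v (w_vec \<pi> \<beta> \<alpha>) =
      (\<Sum>\<xi>\<in>UNIV. (if \<pi> Bot \<xi> < \<pi> Bot \<beta> then v \<xi> else 0) - (if \<pi> Top \<xi> < \<pi> Top \<alpha> then v \<xi> else 0))"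
    unfolding pairing_def w_vec_def unit by (intro sum.cong) auto
  also have "\<dots> = (\<Sum>\<chi> | \<pi> Bot \<chi> < \<pi> Bot \<beta>. v \<chi>) - (\<Sum>\<chi> | \<pi> Top \<chi> < \<pi> Top \<alpha>. v \<chi>)"
    by (simp add: sum_subtractf sum.If_cases)
  finally show ?thesis .
qed

text \<open>Cleared of its denominator, the bound survives area \<open>0\<close>, where the left
  side vanishes.\<close>

lemma w_fun_mult_area_le:
  assumes "(\<pi>, lam, \<tau>) \<in> cls_data" and "\<pi> Bot \<beta> > 1" and "\<pi> Top \<alpha> > 1"
  shows "w_fun (\<pi>, lam, \<tau>) * area (\<pi>, lam, \<tau>)
    \<le> \<bar>pairing lam (w_vec \<pi> \<beta> \<alpha>)\<bar> * \<bar>pairing \<tau> (w_vec \<pi> \<beta> \<alpha>)\<bar>"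
proof (cases "area (\<pi>, lam, \<tau>) = 0")
  case False
  let ?f = "\<lambda>(\<beta>, \<alpha>). \<bar>pairing lam (w_vec \<pi> \<beta> \<alpha>)\<bar> * \<bar>pairing \<tau> (w_vec \<pi> \<beta> \<alpha>)\<bar>"
  let ?A = "{\<bar>pairing lam (w_vec \<pi> \<beta> \<alpha>)\<bar> * \<bar>pairing \<tau> (w_vec \<pi> \<beta> \<alpha>)\<bar> | \<beta> \<alpha>.
            \<pi> Bot \<beta> > 1 \<and> \<pi> Top \<alpha> > 1}"
  have "?A \<subseteq> range ?f" by auto
  then have "finite ?A" by (rule finite_subset) simp
  then have "Min ?A \<le> \<bar>pairing lam (w_vec \<pi> \<beta> \<alpha>)\<bar> * \<bar>pairing \<tau> (w_vec \<pi> \<beta> \<alpha>)\<bar>"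
    using assms(2,3) by (intro Min_le) auto
  then show ?thesis using False by (simp add: w_fun_def)
qed simp

lemma w_fun_nonneg:
  fixes \<pi> :: "'a::finite comb"
  assumes "CARD('a) \<ge> 2" and "(\<pi>, lam, \<tau>) \<in> cls_data"
  shows "w_fun (\<pi>, lam, \<tau>) \<ge> 0"
proof -
  let ?f = "\<lambda>(\<beta>, \<alpha>). \<bar>pairing lam (w_vec \<pi> \<beta> \<alpha>)\<bar> * \<bar>pairing \<tau> (w_vec \<pi> \<beta> \<alpha>)\<bar>"
  let ?A = "{\<bar>pairing lam (w_vec \<pi> \<beta> \<alpha>)\<bar> * \<bar>pairing \<tau> (w_vec \<pi> \<beta> \<alpha>)\<bar> | \<beta> \<alpha>.
            \<pi> Bot \<beta> > 1 \<and> \<pi> Top \<alpha> > 1}"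
  have datum: "combinatorial_datum \<pi>" using assms(2) by (simp add: cls_data_def)
  \<comment> \<open>Both last letters stand at position \<open>d\<close>, which is at least
    \<open>2\<close>, so the minimum runs over a nonempty set.\<close>
  have "\<pi> \<epsilon> (last_letter \<pi> \<epsilon>) > 1" for \<epsilon>
    using last_letter_iff[OF datum] assms(1) by (metis Suc_1 Suc_le_lessD)
  then have "?A \<noteq> {}" by blast
  moreover have "?A \<subseteq> range ?f" by auto
  then have "finite ?A" by (rule finite_subset) simp
  ultimately have "Min ?A \<ge> 0" by (subst Min_ge_iff) auto
  then show ?thesis
    using area_nonneg[OF assms(2)] by (simp add: w_fun_def)
qed

text \<open>
  For the two last letters, the \<open>\<tau>\<close>-factor in \<open>w\<close> is at most the sum of their heights, and the
  area is at least that sum times the length of the loser.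
\<close>

lemma w_fun_mult_loser_le:
  fixes \<pi> :: "'a::finite comb"
  assumes "CARD('a) \<ge> 2" and "(\<pi>, lam, \<tau>) \<in> cls_data"
    and "0 \<le> \<mu>" and "\<mu> \<le> w_fun (\<pi>, lam, \<tau>)"
    and "{w, l} = {last_letter \<pi> Top, last_letter \<pi> Bot}" and "lam l < lam w"
  shows "\<mu> * lam l \<le> lam w - lam l"
proof -
  let ?a = "last_letter \<pi> Top" and ?b = "last_letter \<pi> Bot"
  have datum: "combinatorial_datum \<pi>" and susp: "suspension_datum \<pi> \<tau>"
    and pos: "\<And>\<alpha>. lam \<alpha> > 0"
    using assms(2) by (auto simp: cls_data_def length_datum_def)
  note before = suspension_datum_before[OF datum susp]
  have wl: "w \<noteq> l" using assms(6) by auto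
  have gt1: "\<pi> \<epsilon> (last_letter \<pi> \<epsilon>) > 1" for \<epsilon>
    using last_letter_iff[OF datum] assms(1) by (metis Suc_1 Suc_le_lessD)
  let ?H = "height \<pi> \<tau> w + height \<pi> \<tau> l"
  have H: "?H = height \<pi> \<tau> ?a + height \<pi> \<tau> ?b"
    using assms(5) by (auto simp: doubleton_eq_iff)
  \<comment> \<open>Each prefix sum is the total length minus one last letter, so the totals
    cancel.\<close>
  have lam_eq: "\<bar>pairing lam (w_vec \<pi> ?b ?a)\<bar> = lam w - lam l"
    using assms(5,6) unfolding pairing_w_vec sum_before_last_letter[OF datum]
    by (auto simp: doubleton_eq_iff)
  \<comment> \<open>The pairing involves the top prefix of \<open>?a\<close> and the bottom prefix
    of \<open>?b\<close>, of opposite strict signs; the two further terms of \<open>?H\<close> are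
    nonnegative.\<close>
  have tau_le: "\<bar>pairing \<tau> (w_vec \<pi> ?b ?a)\<bar> \<le> ?H" and H_pos: "0 < ?H"
    using before(1)[OF gt1] before(2)[OF gt1] before(4)[of ?a] before(3)[of ?b]
    unfolding H unfolding pairing_w_vec height_def by linarith+
  \<comment> \<open>The area is bounded below by the contributions of \<open>w\<close> and
    \<open>l\<close> alone, with \<open>lam w\<close> lowered to \<open>lam l\<close>.\<close>
  have "lam l * ?H \<le> lam w * height \<pi> \<tau> w + lam l * height \<pi> \<tau> l"
    using assms(6) height_nonneg[OF datum susp, of w] by (simp add: distrib_left mult_right_mono)
  also have "\<dots> = (\<Sum>\<alpha>\<in>{w, l}. lam \<alpha> * height \<pi> \<tau> \<alpha>)" using wl by simp
  also have "\<dots> \<le> area (\<pi>, lam, \<tau>)"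
    unfolding area_def prod.case
    using height_nonneg[OF datum susp] pos by (intro sum_mono2) (auto simp: less_imp_le)
  finally have area: "lam l * ?H \<le> area (\<pi>, lam, \<tau>)" .
  have "\<mu> * lam l * ?H \<le> \<mu> * area (\<pi>, lam, \<tau>)"
    using mult_left_mono[OF area assms(3)] by (simp add: mult.assoc)
  also have "\<dots> \<le> w_fun (\<pi>, lam, \<tau>) * area (\<pi>, lam, \<tau>)"
    using assms(4) area_nonneg[OF assms(2)] by (rule mult_right_mono)
  also have "\<dots> \<le> \<bar>pairing lam (w_vec \<pi> ?b ?a)\<bar> * \<bar>pairing \<tau> (w_vec \<pi> ?b ?a)\<bar>"
    using w_fun_mult_area_le[OF assms(2) gt1 gt1] .
  also have "\<dots> \<le> (lam w - lam l) * ?H"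
    unfolding lam_eq using tau_le assms(6) by (intro mult_left_mono) auto
  finally show ?thesis using H_pos by simp
qed

section \<open>Arrows of a forward orbit segment\<close>

lemma opp_neq [simp]: "opp \<epsilon> \<noteq> \<epsilon>" "\<epsilon> \<noteq> opp \<epsilon>"
  by (cases \<epsilon>; simp)+

text \<open>Time runs forward: the past of the given datum becomes a segment that ends with this
  datum at \<open>X M\<close>.\<close>

locale rv_segment =
  fixes X :: "nat \<Rightarrow> 'a::finite data" and M :: nat and \<mu> :: real
  assumes card_ge: "CARD('a) \<ge> 2"
    and domain: "i < M \<Longrightarrow> X i \<in> rv_domain"
    and step: "i < M \<Longrightarrow> X (Suc i) = rv_map (X i)"
    and end_cls: "X M \<in> cls_data"
    and mu_pos: "0 < \<mu>"
    and mu_le: "i < M \<Longrightarrow> \<mu> \<le> w_fun (X i)"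
begin

definition comb where "comb i = fst (X i)"
definition len where "len i = fst (snd (X i))"
definition susp where "susp i = snd (snd (X i))"
text \<open>The row that the step leaves fixed; the loser moves in the opposite one.\<close>

definition row where "row i = snd (rv_arrow (X i))"
definition win where "win i = winner (rv_arrow (X i))"
definition lose where "lose i = loser (rv_arrow (X i))"

lemma X_eq: "X i = (comb i, len i, susp i)"
  by (simp add: comb_def len_def susp_def)

lemma cls: "i \<le> M \<Longrightarrow> X i \<in> cls_data"
  using domain[of i] end_cls by (cases "i = M") (auto simp: rv_domain_def)

lemma datum: "i \<le> M \<Longrightarrow> combinatorial_datum (comb i)"
  using cls[of i] X_eq[of i] by (auto simp: cls_data_def)

lemma len_pos: "i \<le> M \<Longrightarrow> 0 < len i \<alpha>"
  using cls[of i] X_eq[of i] by (auto simp: cls_data_def length_datum_def)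

lemma arrow_eq: "rv_arrow (X i) = (comb i, row i)"
  using X_eq[of i] by (simp add: row_def rv_arrow_def split: prod.splits)

lemma win_eq: "win i = last_letter (comb i) (row i)"
  and lose_eq: "lose i = last_letter (comb i) (opp (row i))"
  by (simp_all add: win_def lose_def arrow_eq winner_def loser_def)

lemma pair_eq: "{win i, lose i} = {last_letter (comb i) Top, last_letter (comb i) Bot}"
  unfolding win_eq lose_eq by (cases "row i") auto

lemma len_lose_less: "i < M \<Longrightarrow> len i (lose i) < len i (win i)"
  using domain[of i] X_eq[of i] row_def[of i]
  by (auto simp: rv_domain_def rv_arrow_def win_eq lose_eq split: if_splits)

lemma win_neq_lose: "i < M \<Longrightarrow> win i \<noteq> lose i"
  using len_lose_less[of i] by auto

lemma len_Suc: "i < M \<Longrightarrow> len (Suc i) = (len i)(win i := len i (win i) - len i (lose i))"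
  using step[of i] X_eq[of i] win_def[of i] lose_def[of i]
  by (simp add: len_def[of "Suc i"] rv_map_def Let_def split: prod.splits)

lemma comb_Suc: "i < M \<Longrightarrow> comb (Suc i) = target (comb i, row i)"
  using step[of i] X_eq[of i] arrow_eq[of i]
  by (simp add: comb_def[of "Suc i"] rv_map_def Let_def split: prod.splits)

lemma comb_Suc_winner_row: "i < M \<Longrightarrow> comb (Suc i) (row i) = comb i (row i)"
  by (simp add: comb_Suc target_def Let_def)

lemma comb_Suc_loser_row:
  assumes "i < M"
  defines "\<sigma> \<equiv> opp (row i)"
  shows "comb (Suc i) \<sigma> \<chi> =
    (if \<chi> = lose i then comb i \<sigma> (win i) + 1
     else if comb i \<sigma> \<chi> \<le> comb i \<sigma> (win i) then comb i \<sigma> \<chi> else comb i \<sigma> \<chi> + 1)"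
  using assms by (simp add: comb_Suc target_def Let_def win_def lose_def arrow_eq)

lemma last_win: "i \<le> M \<Longrightarrow> comb i (row i) \<alpha> = CARD('a) \<longleftrightarrow> \<alpha> = win i"
  and last_lose: "i \<le> M \<Longrightarrow> comb i (opp (row i)) \<alpha> = CARD('a) \<longleftrightarrow> \<alpha> = lose i"
  unfolding win_eq lose_eq by (simp_all add: last_letter_iff datum)

text \<open>The row of the winner does not change, so the winner is still last there when the next
  arrow starts.\<close>

lemma win_in_next: "Suc i < M \<Longrightarrow> win i \<in> {win (Suc i), lose (Suc i)}"
proof -
  assume i: "Suc i < M"
  then have "comb (Suc i) (row i) (win i) = CARD('a)"
    using last_win[of i] by (simp add: comb_Suc_winner_row)
  then have "win i = last_letter (comb (Suc i)) (row i)"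
    using i last_letter_iff[OF datum] by simp
  then show ?thesis
    unfolding pair_eq by (cases "row i") auto
qed

text \<open>The difference of lengths in \<open>w_fun_mult_loser_le\<close> is the new length of the
  winner.\<close>

lemma mu_lose_le: "i < M \<Longrightarrow> \<mu> * len i (lose i) \<le> len (Suc i) (win i)"
  using w_fun_mult_loser_le[OF card_ge, of "comb i" "len i" _ \<mu>] cls[of i] mu_le[of i] mu_pos
    X_eq[of i] pair_eq[of i] len_lose_less[of i]
  by (simp add: len_Suc)

section \<open>Lengths along the segment and the letters beaten in it\<close>

lemma len_mono: "i \<le> j \<Longrightarrow> j \<le> M \<Longrightarrow> len j \<alpha> \<le> len i \<alpha>"
proof (induction j rule: dec_induct)
  case (step j)
  then have "len (Suc j) \<alpha> \<le> len j \<alpha>"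
    using len_pos[of j "lose j"] by (simp add: len_Suc)
  then show ?case using step by simp
qed simp

lemma len_unchanged:
  "i \<le> j \<Longrightarrow> j \<le> M \<Longrightarrow> (\<And>k. i \<le> k \<Longrightarrow> k < j \<Longrightarrow> win k \<noteq> \<alpha>) \<Longrightarrow> len j \<alpha> = len i \<alpha>"
proof (induction j rule: dec_induct)
  case (step j)
  then have "win j \<noteq> \<alpha>" and "len j \<alpha> = len i \<alpha>" by auto
  then show ?case using step.prems by (simp add: len_Suc)
qed simp

text \<open>
  The set \<open>D\<close> consists of \<open>win r\<close>, the letters that it has beaten since step \<open>r\<close>, the letters
  beaten by these, and so on.
\<close>

lemma len_win_le_sum:
  assumes "r < e" and "e \<le> M"
    and "win r \<in> S" and "lose r \<notin> S"
    and inside: "\<And>i. r < i \<Longrightarrow> i < e \<Longrightarrow> win i \<in> S \<and> lose i \<in> S"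
  defines "\<sigma> \<equiv> opp (row r)"
  shows "\<exists>D\<subseteq>S. len (Suc r) (win r) \<le> sum (len e) D \<and>
           (\<forall>\<delta>\<in>D. comb e \<sigma> \<delta> < comb e \<sigma> (lose r))"
  using Suc_leI[OF assms(1)] assms(2) inside
proof (induction e rule: dec_induct)
  case base
  have "comb (Suc r) \<sigma> (win r) < comb (Suc r) \<sigma> (lose r)"
    using base win_neq_lose[of r] by (simp add: \<sigma>_def comb_Suc_loser_row)
  then show ?case
    using assms(3) by (intro exI[of _ "{win r}"]) auto
next
  case (step i)
  then obtain D where D: "D \<subseteq> S" "len (Suc r) (win r) \<le> sum (len i) D"
      and before: "\<And>\<delta>. \<delta> \<in> D \<Longrightarrow> comb i \<sigma> \<delta> < comb i \<sigma> (lose r)"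
    by fastforce
  from step have i: "i < M" and S: "win i \<in> S" "lose i \<in> S" by auto
  \<comment> \<open>Letters of \<open>D\<close> precede \<open>lose r\<close>, so none is last in
    row \<open>\<sigma>\<close>; hence the letter of the arrow that is last in this row lies outside
    \<open>D\<close>.\<close>
  have below: "comb i \<sigma> \<delta> < CARD('a)" if "\<delta> \<in> D" for \<delta>
    using before[OF that] combinatorial_datum_range(2)[OF datum[of i]] i
    by (meson less_imp_le order_less_le_trans)
  consider "row i = \<sigma>" | "opp (row i) = \<sigma>" by (cases "row i"; cases \<sigma>) auto
  then show ?case
  proof cases
    case 1
    then have "win i \<notin> D" using below[of "win i"] last_win[of i "win i"] i by auto
    then have "sum (len (Suc i)) D = sum (len i) D"
      using i by (intro sum.cong) (auto simp: len_Suc)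
    then show ?thesis
      using D before comb_Suc_winner_row[OF i] 1 by (intro exI[of _ D]) auto
  next
    case 2
    then have lose: "lose i \<notin> D" using below[of "lose i"] last_lose[of i "lose i"] i by auto
    have neq: "lose i \<noteq> lose r" using S assms(4) by auto
    have shift: "comb (Suc i) \<sigma> \<chi> =
        (if \<chi> = lose i then comb i \<sigma> (win i) + 1
         else if comb i \<sigma> \<chi> \<le> comb i \<sigma> (win i) then comb i \<sigma> \<chi> else comb i \<sigma> \<chi> + 1)" for \<chi>
      using comb_Suc_loser_row[OF i] 2 by simp
    \<comment> \<open>Moving \<open>lose i\<close> keeps the order of the other letters, and
      \<open>lose r\<close> is among these because it lies outside \<open>S\<close>.\<close>
    have before': "comb (Suc i) \<sigma> \<delta> < comb (Suc i) \<sigma> (lose r)" if "\<delta> \<in> D" for \<delta>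
      using before[OF that] lose that neq by (auto simp: shift)
    show ?thesis
    proof (cases "win i \<in> D")
      case True
      have "sum (len (Suc i)) (D - {win i}) = sum (len i) (D - {win i})"
        using i by (intro sum.cong) (auto simp: len_Suc)
      \<comment> \<open>Adding \<open>lose i\<close> restores exactly what the step subtracts from
        \<open>win i\<close>.\<close>
      then have "sum (len (Suc i)) (insert (lose i) D) = sum (len i) D"
        using True lose win_neq_lose[OF i] i
        by (simp add: sum.remove[of D "win i"] len_Suc)
      \<comment> \<open>\<open>lose i\<close> enters right behind \<open>win i\<close>, which
        precedes \<open>lose r\<close>, and thereby pushes \<open>lose r\<close> one place to the
        right.\<close>
      moreover have "comb (Suc i) \<sigma> (lose i) < comb (Suc i) \<sigma> (lose r)"
        using before[OF True] neq by (auto simp: shift)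
      ultimately show ?thesis
        using D S before' by (intro exI[of _ "insert (lose i) D"]) auto
    next
      case False
      then have "sum (len (Suc i)) D = sum (len i) D"
        using i by (intro sum.cong) (auto simp: len_Suc)
      then show ?thesis
        using D before' by (intro exI[of _ D]) auto
    qed
  qed
qed

text \<open>The split at \<open>j\<close> ensures that a letter outside \<open>S\<close> wins before
  the last win of a letter of \<open>S\<close>, so the search back from that win succeeds.\<close>

lemma small_set_extends:
  fixes c :: real
  assumes "S \<noteq> {}" and "S \<noteq> UNIV"
    and "j \<le> M"
    and first: "\<And>\<alpha>. \<exists>i<j. win i = \<alpha>" and second: "\<And>\<alpha>. \<exists>i<M. j \<le> i \<and> win i = \<alpha>"
    and small: "\<And>\<alpha>. \<alpha> \<in> S \<Longrightarrow> len M \<alpha> \<le> c"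
  shows "\<exists>l. l \<notin> S \<and> \<mu> * len M l \<le> card S * c"
proof -
  define r1 where "r1 = Max {i. i < M \<and> win i \<in> S}"
  obtain \<beta> where "\<beta> \<in> S" using assms(1) by blast
  then obtain i1 where i1: "i1 < M" "j \<le> i1" "win i1 \<in> S" using second[of \<beta>] by auto
  have "r1 \<in> {i. i < M \<and> win i \<in> S}"
    unfolding r1_def using i1 by (intro Max_in) auto
  then have r1: "r1 < M" "win r1 \<in> S" by auto
  have r1_max: "i \<le> r1" if "i < M" "win i \<in> S" for i
    unfolding r1_def using that by (intro Max_ge) auto
  define r0 where "r0 = Max {i. i \<le> r1 \<and> \<not> (win i \<in> S \<and> lose i \<in> S)}"
  obtain \<alpha> where "\<alpha> \<notin> S" using assms(2) by blast
  then obtain i0 where i0: "i0 < j" "win i0 \<notin> S" using first[of \<alpha>] by auto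
  have "i0 \<le> r1" using i0(1) i1 r1_max[of i1] by simp
  then have "{i. i \<le> r1 \<and> \<not> (win i \<in> S \<and> lose i \<in> S)} \<noteq> {}" using i0(2) by blast
  then have "r0 \<in> {i. i \<le> r1 \<and> \<not> (win i \<in> S \<and> lose i \<in> S)}"
    unfolding r0_def by (intro Max_in) simp_all
  then have r0: "r0 \<le> r1" "\<not> (win r0 \<in> S \<and> lose r0 \<in> S)" by auto
  have inside: "win i \<in> S \<and> lose i \<in> S" if "r0 < i" "i < Suc r1" for i
  proof (rule ccontr)
    assume "\<not> (win i \<in> S \<and> lose i \<in> S)"
    then have "i \<le> r0" unfolding r0_def using that by (intro Max_ge) auto
    then show False using that by simp
  qed
  \<comment> \<open>If \<open>r0 < r1\<close>, the arrow after \<open>r0\<close> lies inside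
    \<open>S\<close> and still involves \<open>win r0\<close>.\<close>
  have win0: "win r0 \<in> S"
  proof (cases "r0 = r1")
    case False
    then show ?thesis
      using win_in_next[of r0] inside[of "Suc r0"] r0 r1 by auto
  qed (use r1 in simp)
  with r0 have lose0: "lose r0 \<notin> S" by simp
  obtain D where D: "D \<subseteq> S" "len (Suc r0) (win r0) \<le> sum (len (Suc r1)) D"
    using len_win_le_sum[of r0 "Suc r1" S] r0 r1 win0 lose0 inside by auto
  have "\<mu> * len M (lose r0) \<le> \<mu> * len r0 (lose r0)"
    using len_mono[of r0 M] r0 r1 mu_pos by (intro mult_left_mono) auto
  also have "\<dots> \<le> len (Suc r0) (win r0)" using mu_lose_le r0 r1 by simp
  also have "\<dots> \<le> sum (len (Suc r1)) D" by (fact D)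
  also have "\<dots> \<le> sum (len (Suc r1)) S"
    using D r1 len_pos[of "Suc r1"] by (intro sum_mono2) (auto simp: less_imp_le)
  \<comment> \<open>No letter of \<open>S\<close> wins after \<open>r1\<close>, so these lengths are
    already final.\<close>
  also have "\<dots> = sum (len M) S"
  proof (intro sum.cong refl len_unchanged[symmetric])
    fix \<alpha> k assume "\<alpha> \<in> S" "Suc r1 \<le> k" "k < M"
    then show "win k \<noteq> \<alpha>" using r1_max[of k] by auto
  qed (use r1 in auto)
  also have "\<dots> \<le> card S * c" using small by (rule sum_bounded_above)
  finally show ?thesis using lose0 by blast
qed

section \<open>The distortion bound for a segment\<close>

lemma mu_le_one:
  assumes "\<And>\<alpha>. \<exists>i<M. win i = \<alpha>"
  shows "\<mu> \<le> 1"
proof -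
  have fin: "finite (range (len M))" by simp
  then have "Min (range (len M)) \<in> range (len M)" by (rule Min_in) simp
  then obtain \<gamma> where \<gamma>: "Min (range (len M)) = len M \<gamma>" by (rule imageE)
  then have min: "len M \<gamma> \<le> len M \<alpha>" for \<alpha> using Min_le[OF fin, of "len M \<alpha>"] by simp
  \<comment> \<open>At the last win of a finally shortest letter \<open>\<gamma>\<close>, the loser
    is at least as long as the final \<open>\<gamma>\<close>.\<close>
  define r where "r = Max {i. i < M \<and> win i = \<gamma>}"
  have "r \<in> {i. i < M \<and> win i = \<gamma>}"
    unfolding r_def using assms[of \<gamma>] by (intro Max_in) auto
  then have r: "r < M" "win r = \<gamma>" by auto
  have "win k \<noteq> \<gamma>" if "Suc r \<le> k" "k < M" for k
  proof
    assume "win k = \<gamma>"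
    then have "k \<le> r" unfolding r_def using that by (intro Max_ge) auto
    then show False using that by simp
  qed
  then have final: "len M \<gamma> = len (Suc r) \<gamma>"
    using r by (intro len_unchanged) auto
  have "\<mu> * len M \<gamma> \<le> \<mu> * len r (lose r)"
    using order_trans[OF min len_mono[of r M]] r mu_pos by (intro mult_left_mono) auto
  also have "\<dots> \<le> 1 * len M \<gamma>" using mu_lose_le[OF r(1)] r final by simp
  finally show ?thesis using len_pos[of M \<gamma>] by simp
qed

lemma len_ratio_le:
  assumes "j \<le> M"
    and first: "\<And>\<alpha>. \<exists>i<j. win i = \<alpha>" and second: "\<And>\<alpha>. \<exists>i<M. j \<le> i \<and> win i = \<alpha>"
  shows "len M \<alpha> / len M \<beta> \<le> fact (CARD('a) - 1) / \<mu> ^ (CARD('a) - 1)"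
proof -
  have mu1: "\<mu> \<le> 1" using second by (intro mu_le_one) blast
  \<comment> \<open>Starting from \<open>{\<beta>}\<close>, adding a letter to a set of
    \<open>k + 1\<close> letters multiplies the bound by \<open>(k + 1) / \<mu>\<close>.\<close>
  have "\<exists>S. card S = Suc k \<and> (\<forall>\<gamma>\<in>S. len M \<gamma> \<le> fact k * len M \<beta> / \<mu> ^ k)" if "Suc k \<le> CARD('a)" for k
    using that
  proof (induction k)
    case 0
    then show ?case by (intro exI[of _ "{\<beta>}"]) simp
  next
    case (Suc k)
    let ?c = "fact k * len M \<beta> / \<mu> ^ k"
    from Suc obtain S where S: "card S = Suc k" "\<And>\<gamma>. \<gamma> \<in> S \<Longrightarrow> len M \<gamma> \<le> ?c" by auto
    have "S \<noteq> {}" "S \<noteq> UNIV" using S(1) Suc.prems by auto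
    from small_set_extends[OF this assms S(2)]
    obtain l where l: "l \<notin> S" "\<mu> * len M l \<le> card S * ?c" by blast
    have eq: "real (Suc k) * ?c / \<mu> = fact (Suc k) * len M \<beta> / \<mu> ^ Suc k" by (simp add: mult_ac)
    have c: "?c \<ge> 0" using len_pos[of M \<beta>] mu_pos by simp
    \<comment> \<open>The old letters must also meet the new bound; this is where
      \<open>\<mu> \<le> 1\<close> enters.\<close>
    have "1 * ?c \<le> real (Suc k) * ?c" using c by (intro mult_right_mono) auto
    also have "\<dots> = real (Suc k) * ?c / 1" by (rule div_by_1[symmetric])
    also have "\<dots> \<le> real (Suc k) * ?c / \<mu>"
      using mu1 mu_pos by (intro divide_left_mono mult_nonneg_nonneg[OF of_nat_0_le_iff c]) auto
    finally have "?c \<le> fact (Suc k) * len M \<beta> / \<mu> ^ Suc k" unfolding eq mult_1 .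
    moreover have "len M l \<le> fact (Suc k) * len M \<beta> / \<mu> ^ Suc k"
      using l(2) unfolding S(1) eq[symmetric] pos_le_divide_eq[OF mu_pos] by (simp only: mult.commute)
    ultimately show ?case
      using S l(1) by (intro exI[of _ "insert l S"]) (force simp: card_insert_if)
  qed
  from this[of "CARD('a) - 1"] obtain S :: "'a set" where "card S = CARD('a)"
    and S: "\<And>\<gamma>. \<gamma> \<in> S \<Longrightarrow>
      len M \<gamma> \<le> fact (CARD('a) - 1) * len M \<beta> / \<mu> ^ (CARD('a) - 1)"
    using card_ge by auto
  then have "S = UNIV" by (simp add: card_eq_UNIV_imp_eq_UNIV)
  with S[of \<alpha>] show ?thesis
    using len_pos[of M \<beta>] by (simp add: pos_divide_le_eq)
qed

end

section \<open>Application to the past of a datum\<close>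

lemma concat_complete_split:
  fixes ps :: "'a::finite arrow list list"
  assumes "length ps \<ge> 2" and "\<forall>p\<in>set ps. complete_path p"
  obtains j where "j \<le> length (concat ps)"
    and "\<And>\<alpha>. \<exists>i<j. winner (concat ps ! i) = \<alpha>"
    and "\<And>\<alpha>. \<exists>i<length (concat ps). j \<le> i \<and> winner (concat ps ! i) = \<alpha>"
proof -
  \<comment> \<open>Two complete pieces suffice: \<open>p\<close> supplies the wins before
    \<open>j\<close> and \<open>q\<close> those from \<open>j\<close> on.\<close>
  from assms(1) obtain p q qs where ps: "ps = p # q # qs"
    by (cases ps rule: remdups_adj.cases) auto
  have wins: "\<exists>i<length r. winner (r ! i) = \<alpha>" if "r \<in> {p, q}" for r \<alpha>
  proof -
    have "complete_path r" using assms(2) that unfolding ps by auto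
    then obtain \<gamma> where "\<gamma> \<in> set r" "winner \<gamma> = \<alpha>" unfolding complete_path_def by blast
    then show ?thesis by (auto simp: in_set_conv_nth)
  qed
  show ?thesis
  proof (rule that[of "length p"])
    fix \<alpha>
    from wins[of p \<alpha>] obtain i where "i < length p" "winner (p ! i) = \<alpha>" by auto
    then show "\<exists>i<length p. winner (concat ps ! i) = \<alpha>"
      by (intro exI[of _ i]) (simp add: ps nth_append)
    from wins[of q \<alpha>] obtain i where "i < length q" "winner (q ! i) = \<alpha>" by auto
    then show "\<exists>i<length (concat ps). length p \<le> i \<and> winner (concat ps ! i) = \<alpha>"
      by (intro exI[of _ "length p + i"]) (simp add: ps nth_append)
  qed (simp add: ps)
qed

text \<open>\<open>infinite_past\<close> puts every \<open>rv_past n x\<close> in the image of the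
  domain, where \<open>inv_into\<close> returns a genuine preimage.\<close>

lemma rv_past_Suc:
  assumes "infinite_past x"
  shows "rv_past (Suc n) x \<in> rv_domain" and "rv_map (rv_past (Suc n) x) = rv_past n x"
  using assms unfolding infinite_past_def rv_past_def rv_inv_def
  by (auto simp: inv_into_into f_inv_into_f)

theorem proposition4p10:
  fixes \<pi> :: "'a::finite comb" and lam \<tau> :: "'a vec"
  assumes "CARD('a) \<ge> 2"
    and "combinatorial_datum \<pi>" and "length_datum lam" and "suspension_datum \<pi> \<tau>"
    and "infinite_past (\<pi>, lam, \<tau>)"
    and "\<exists>m>0. strongly_complete_path (past_path (\<pi>, lam, \<tau>) m)"
  shows "ereal (distortion lam)
           \<le> ereal (fact CARD('a)) / ereal (min_w (\<pi>, lam, \<tau>)) ^ (CARD('a) - 1)"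
proof -
  let ?d = "CARD('a)"
  define x where "x = (\<pi>, lam, \<tau>)"
  define M where "M = min_past_length x"
  define X where "X i = rv_past (M - i) x" for i
  define \<mu> where "\<mu> = min_w x"
  have cls: "rv_past n x \<in> cls_data" for n
  proof (cases n)
    case 0
    then show ?thesis using assms by (simp add: rv_past_def x_def cls_data_def)
  next
    case (Suc k)
    then show ?thesis
      using rv_past_Suc(1)[of x k] assms(5) by (auto simp: x_def rv_domain_def)
  qed
  have mu_le: "\<mu> \<le> w_fun (rv_past n x)" if "n \<le> M" for n
    unfolding \<mu>_def min_w_def M_def[symmetric] using that by (intro Min_le) auto
  have "w_fun (rv_past n x) \<ge> 0" for n
    using w_fun_nonneg[OF assms(1)] cls[of n] by (metis prod.exhaust)
  then have "\<mu> \<ge> 0"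
    unfolding \<mu>_def min_w_def by (subst Min_ge_iff) auto
  then consider "\<mu> = 0" | "\<mu> > 0" by linarith
  then show ?thesis
  proof cases
    case 1
    \<comment> \<open>The exponent is positive, so the denominator vanishes and the bound is
      infinite.\<close>
    then have "\<mu> ^ (?d - 1) = 0" using assms(1) by simp
    then have "ereal (fact ?d) / ereal \<mu> ^ (?d - 1) = \<infinity>"
      by (simp add: divide_ereal_def)
    then show ?thesis by (simp add: \<mu>_def x_def)
  next
    case 2
    interpret rv_segment X M \<mu>
    proof
      fix i assume i: "i < M"
      then have "M - i = Suc (M - Suc i)" by simp
      then show "X i \<in> rv_domain" and "X (Suc i) = rv_map (X i)"
        using rv_past_Suc[of x "M - Suc i"] assms(5) by (simp_all add: X_def x_def)
      show "\<mu> \<le> w_fun (X i)" using mu_le[of "M - i"] by (simp add: X_def)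
    qed (use assms(1) cls 2 in \<open>simp_all add: X_def\<close>)
    have "strongly_complete_path (past_path x M)"
      using assms(6) unfolding M_def min_past_length_def x_def by (metis (mono_tags, lifting) LeastI)
    then obtain ps where ps: "length ps = ?d" "\<forall>p\<in>set ps. complete_path p" "past_path x M = concat ps"
      unfolding strongly_complete_path_def by blast
    have len_path: "length (concat ps) = M"
      unfolding ps(3)[symmetric] by (simp add: past_path_def)
    \<comment> \<open>\<open>past_path\<close> lists the inverse steps from \<open>M\<close> down to
      \<open>1\<close>, so its entry \<open>i\<close> is the arrow at
      \<open>rv_past (M - i) x\<close>, that is at \<open>X i\<close>.\<close>
    have nth: "winner (concat ps ! i) = win i" if "i < M" for i
      unfolding ps(3)[symmetric] using that
      by (simp add: past_path_def win_def X_def rev_nth Suc_diff_Suc del: upt_Suc)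
    obtain j where j: "j \<le> M" "\<And>\<alpha>. \<exists>i<j. winner (concat ps ! i) = \<alpha>"
        "\<And>\<alpha>. \<exists>i<M. j \<le> i \<and> winner (concat ps ! i) = \<alpha>"
      using concat_complete_split[of ps] ps assms(1) unfolding len_path by metis
    have lenM: "len M = lam"
      by (simp add: len_def X_def rv_past_def x_def)
    have first: "\<exists>i<j. win i = \<alpha>" for \<alpha>
      using j(1) j(2)[of \<alpha>] nth by (metis order_less_le_trans)
    have second: "\<exists>i<M. j \<le> i \<and> win i = \<alpha>" for \<alpha>
      using j(3)[of \<alpha>] nth by metis
    have ratio: "lam \<alpha> / lam \<beta> \<le> fact ?d / \<mu> ^ (?d - 1)" for \<alpha> \<beta>
    proof -
      have "lam \<alpha> / lam \<beta> \<le> fact (?d - 1) / \<mu> ^ (?d - 1)"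
        using len_ratio_le[OF j(1) first second, of \<alpha> \<beta>] unfolding lenM .
      also have "\<dots> \<le> fact ?d / \<mu> ^ (?d - 1)"
        using 2 by (intro divide_right_mono fact_mono) auto
      finally show ?thesis .
    qed
    have "{lam \<alpha> / lam \<beta> | \<alpha> \<beta>. True} = range (\<lambda>(\<alpha>, \<beta>). lam \<alpha> / lam \<beta>)" by auto
    then have "distortion lam \<le> fact ?d / \<mu> ^ (?d - 1)"
      unfolding distortion_def using ratio by simp
    then show ?thesis
      using 2 by (simp add: \<mu>_def x_def)
  qed
qed

end
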